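(* Let $(X,d)$ be a Polish space and let $(\mathcal{H},\langle\cdot,\cdot\rangle)$ be a separable Hilbert space. If $(X,d)$ splits $(\mathcal{H},\langle\cdot,\cdot\rangle)$, then its $L^2$-Wasserstein space $(\mathcal{P}_2(X),W_2)$ splits $(\mathcal{H},\langle\cdot,\cdot\rangle)$ as well.
   Context: A Polish space is a complete separable metric space. Hilbert spaces are real. $\mathcal{P}_2(X)$ is the set of Borel probability measures on $X$ with finite second moment, endowed with the distance $$W_2(\mu,\nu)=\Bigl(\inf_{\pi\in\Pi(\mu,\nu)}\int_{X\times X}d(x,y)^2\,d\pi(x,y)\Bigr)^{1/2},$$ where $\Pi(\mu,\nu)$ is the set of Borel probability measures on $X\times X$ with marginals $\mu$ and $\nu$. A metric space is said to split a Hilbert space $\mathcal{H}$ if it is isometric to the direct product of $\mathcal{H}$ and some metric space $(Y,d_Y)$, where the direct product carries the distance $\bigl(d_Y(y,y')^2+\|h-h'\|^2\bigr)^{1/2}$ between $(y,h)$ and $(y',h')$. *)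

theory Defs
  imports "HOL-Probability.Probability"
begin

definition couplings ::
  "'a::polish_space measure \<Rightarrow> 'a measure \<Rightarrow> ('a \<times> 'a) measure set" where
  "couplings \<mu> \<nu> =
     {\<pi>. prob_space \<pi> \<and> sets \<pi> = sets borel \<and>
          distr \<pi> borel fst = \<mu> \<and> distr \<pi> borel snd = \<nu>}"

definition P2 :: "'a::polish_space measure set" where
  "P2 = {\<mu>. prob_space \<mu> \<and> sets \<mu> = sets borel \<and>
             (\<exists>x0. (\<integral>\<^sup>+ x. ennreal ((dist x0 x)\<^sup>2) \<partial>\<mu>) < \<infinity>)}"

(* The infimum is taken in ennreal. It is finite for measures in P2, so the conversion
   enn2real loses nothing there. *)
definition W2 :: "'a::polish_space measure \<Rightarrow> 'a measure \<Rightarrow> real" where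
  "W2 \<mu> \<nu> =
     sqrt (enn2real (INF \<pi>\<in>couplings \<mu> \<nu>. \<integral>\<^sup>+ z. ennreal ((dist (fst z) (snd z))\<^sup>2) \<partial>\<pi>))"

definition isometric ::
  "'a set \<Rightarrow> ('a \<Rightarrow> 'a \<Rightarrow> real) \<Rightarrow> 'b set \<Rightarrow> ('b \<Rightarrow> 'b \<Rightarrow> real) \<Rightarrow> bool" where
  "isometric M d N e \<longleftrightarrow>
     (\<exists>f. bij_betw f M N \<and> (\<forall>x\<in>M. \<forall>y\<in>M. e (f x) (f y) = d x y))"

(* HOL cannot quantify over the type of the points of the other factor Y, so Y is taken
   inside the type of the points of M. This is no restriction: Y is isometric to the slice
   of M corresponding to Y \<times> {0}; see splitsI below. On the Hilbert space, dist h h' is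
   norm (h - h'). *)
definition splits ::
  "'a set \<Rightarrow> ('a \<Rightarrow> 'a \<Rightarrow> real) \<Rightarrow> 'h::{real_inner, complete_space} itself \<Rightarrow> bool" where
  "splits M d (H :: 'h itself) \<longleftrightarrow>
     Metric_space M d \<and>
     (\<exists>(Y :: 'a set) dY. Metric_space Y dY \<and>
        isometric M d (Y \<times> (UNIV :: 'h set)) (prod_dist dY dist))"

lemma splitsI:
  fixes M :: "'a set" and Y :: "'b set"
  assumes M: "Metric_space M d" and Y: "Metric_space Y dY"
    and iso: "isometric M d (Y \<times> (UNIV :: 'h::{real_inner, complete_space} set)) (prod_dist dY dist)"
  shows "splits M d TYPE('h)"
proof -
  obtain f where f: "bij_betw f M (Y \<times> (UNIV :: 'h set))"
    and d: "\<And>x y. x \<in> M \<Longrightarrow> y \<in> M \<Longrightarrow> prod_dist dY dist (f x) (f y) = d x y"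
    using iso unfolding isometric_def by blast
  define r where "r y = inv_into M f (y, 0)" for y
  have r: "r y \<in> M" "f (r y) = (y, 0)" if "y \<in> Y" for y
    using that f bij_betw_inv_into_right[OF f, of "(y, 0)"]
      bij_betwE[OF bij_betw_inv_into[OF f]]
    by (auto simp: r_def)
  have nn: "dY u v \<ge> 0" for u v
    using Y by (rule Metric_space.nonneg)
  have dr: "d (r u) (r v) = dY u v" if "u \<in> Y" "v \<in> Y" for u v
    using d[of "r u" "r v"] r that nn by (simp add: prod_dist_def)
  have "r ` Y \<subseteq> M" using r by blast
  then have Y': "Metric_space (r ` Y) d"
    by (rule Metric_space.subspace[OF M])
  have inj: "inj_on r Y"
    by (metis inj_onI prod.inject r(2))
  have "bij_betw (map_prod r id) (Y \<times> (UNIV :: 'h set)) (r ` Y \<times> UNIV)"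
    using inj by (auto simp: bij_betw_def inj_on_def map_prod_def image_iff)
  then have b: "bij_betw (map_prod r id \<circ> f) M (r ` Y \<times> (UNIV :: 'h set))"
    using f bij_betw_trans by blast
  have "prod_dist d dist ((map_prod r id \<circ> f) x) ((map_prod r id \<circ> f) y) = d x y"
    if "x \<in> M" "y \<in> M" for x y
  proof -
    have "fst (f x) \<in> Y" "fst (f y) \<in> Y"
      using bij_betwE[OF f] that by (auto simp: mem_Times_iff)
    then show ?thesis
      using d[OF that] dr by (cases "f x"; cases "f y") (simp add: prod_dist_def)
  qed
  with b have "isometric M d (r ` Y \<times> (UNIV :: 'h set)) (prod_dist d dist)"
    unfolding isometric_def by blast
  with M Y' show ?thesis
    unfolding splits_def by blast
qed

end

(* The translations of H act on X by isometries tau_v. For a coupling pi of mu and nu, pushing the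
   two marginals forward by tau_v and tau_w changes the transport cost by
   2 <m - n, v - w> + |v - w|^2, where m and n are the barycentres of the H-components of mu and nu;
   this does not depend on pi. Taking v = - m and w = - n gives
   W2(mu, nu)^2 = W2(mu', nu')^2 + |m - n|^2 for the centred measures mu' and nu', so P2(X) is the
   product of H and the set of measures with barycentre 0. *)
theory Submission
  imports Defs
begin

text \<open>The coupling drops out because translating changes the squared distance by
  \<open>2 * inner (p x - p y) (v - w)\<close> plus a constant, and the integral of a function of
  \<open>x\<close> minus a function of \<open>y\<close> sees only the marginals. Two obstacles shape
  the rest. \<open>splits\<close> demands that \<open>W2\<close> be a metric on \<open>P2\<close>,
  and the triangle inequality requires joining two couplings along a common marginal; they are
  joined up to an error \<open>e\<close>, by matching cells of a countable partition into sets of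
  diameter at most \<open>e\<close>, and \<open>e\<close> is arbitrary. Moreover, the barycentre is
  a vector known only through its inner products, so its existence rests on the Riesz representation
  theorem. Infima are approached by couplings of nearly minimal cost, with a slack that is removed
  at the end.\<close>

subsection \<open>Riesz representation\<close>

text \<open>The representing vector is the minimiser of a quadratic functional: the parallelogram
  law makes a minimising sequence Cauchy, and the vanishing first variation at its limit is the
  claim.\<close>

lemma riesz_representation:
  fixes f :: "'h::{real_inner, complete_space} \<Rightarrow> real"
  assumes "bounded_linear f"
  obtains m where "\<And>v. f v = inner m v"
proof -
  interpret f: bounded_linear f by fact
  obtain K where K: "\<And>x. norm (f x) \<le> norm x * K"
    using f.bounded by blast
  \<comment> \<open>If \<open>f\<close> is the inner product with \<open>m\<close>, then
    \<open>G x\<close> equals the squared norm of \<open>x - m\<close> minus that of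
    \<open>m\<close>, so \<open>m\<close> is where \<open>G\<close> is smallest.\<close>
  define G where "G x = (norm x)\<^sup>2 - 2 * f x" for x
  have "- (K\<^sup>2) \<le> G x" for x
  proof -
    have "0 \<le> (norm x - K)\<^sup>2" by simp
    moreover have "f x \<le> norm x * K"
      using K[of x] by simp
    ultimately show ?thesis
      by (simp add: G_def power2_diff)
  qed
  then have bdd: "bdd_below (range G)"
    by (intro bdd_belowI2)
  define L where "L = Inf (range G)"
  have L: "L \<le> G x" for x
    using bdd by (simp add: L_def cInf_lower)
  have "\<exists>x. G x < L + inverse (Suc n)" for n
    using cInf_lessD[of "range G" "L + inverse (Suc n)"] by (auto simp: L_def)
  then obtain s where s: "\<And>n. G (s n) < L + inverse (Suc n)"
    by metis
  \<comment> \<open>The linear part of \<open>G\<close> cancels. Since \<open>G\<close> is at least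
    \<open>L\<close> at the midpoint, two points where \<open>G\<close> is nearly \<open>L\<close>
    must be close to each other.\<close>
  have parallelogram: "(norm (a - b))\<^sup>2 = 2 * G a + 2 * G b - 4 * G ((1/2) *\<^sub>R (a + b))" for a b
    by (simp add: G_def f.add f.scaleR power2_norm_eq_inner inner_simps inner_commute
        power_divide field_simps)
  have near: "(norm (s i - s j))\<^sup>2 \<le> 2 * inverse (Suc i) + 2 * inverse (Suc j)" for i j
    using s[of i] s[of j] L[of "(1/2) *\<^sub>R (s i + s j)"] parallelogram[of "s i" "s j"] by linarith
  have "Cauchy s"
  proof (rule CauchyI)
    fix e :: real assume e: "0 < e"
    then have "0 < e\<^sup>2 / 4" by simp
    then obtain N where N: "inverse (real (Suc N)) < e\<^sup>2 / 4"
      using reals_Archimedean by blast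
    have "norm (s i - s j) < e" if "i \<ge> N" "j \<ge> N" for i j
    proof -
      have "inverse (real (Suc i)) \<le> inverse (real (Suc N))"
        "inverse (real (Suc j)) \<le> inverse (real (Suc N))"
        using that by auto
      then have "(norm (s i - s j))\<^sup>2 < e\<^sup>2"
        using near[of i j] N by linarith
      then show ?thesis
        using e by (simp add: power_less_imp_less_base)
    qed
    then show "\<exists>M. \<forall>m\<ge>M. \<forall>n\<ge>M. norm (s m - s n) < e" by blast
  qed
  then obtain m where m: "s \<longlonglongrightarrow> m"
    using Cauchy_convergent convergent_def by blast
  have "(\<lambda>n. G (s n)) \<longlonglongrightarrow> G m"
    unfolding G_def by (intro tendsto_intros m f.tendsto)
  moreover have "(\<lambda>n. L + inverse (real (Suc n))) \<longlonglongrightarrow> L + 0"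
    by (intro tendsto_intros LIMSEQ_inverse_real_of_nat)
  ultimately have Gm: "G m \<le> L"
    using s by (intro LIMSEQ_le[of "\<lambda>n. G (s n)" _ "\<lambda>n. L + inverse (real (Suc n))"])
      (auto intro: less_imp_le)
  have "f v = inner m v" for v
  proof -
    define c where "c = f v - inner m v"
    \<comment> \<open>The choice \<open>t = c / q\<close> below would be the exact minimiser of the
      quadratic in \<open>t\<close> if \<open>q\<close> were the squared norm of \<open>v\<close>;
      the added 1 keeps \<open>q\<close> positive when \<open>v = 0\<close>.\<close>
    define q where "q = (norm v)\<^sup>2 + 1"
    have q: "q > 0" "(norm v)\<^sup>2 < q"
      by (auto simp: q_def add_nonneg_pos)
    have expand: "G (m + t *\<^sub>R v) - G m = t\<^sup>2 * (norm v)\<^sup>2 - 2 * t * c" for t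
    proof -
      have "(norm (m + t *\<^sub>R v))\<^sup>2 = (norm m)\<^sup>2 + 2 * t * inner m v + t\<^sup>2 * (norm v)\<^sup>2"
        unfolding power2_norm_eq_inner
        by (simp add: inner_simps inner_commute power2_eq_square algebra_simps)
      then show ?thesis
        by (simp add: G_def c_def f.add f.scaleR algebra_simps)
    qed
    have "0 \<le> G (m + (c / q) *\<^sub>R v) - G m"
      using Gm L[of "m + (c / q) *\<^sub>R v"] by linarith
    also have "\<dots> = (c / q)\<^sup>2 * (norm v)\<^sup>2 - 2 * (c / q) * c"
      by (rule expand)
    also have "\<dots> \<le> (c / q)\<^sup>2 * q - 2 * (c / q) * c"
      using q by (intro diff_right_mono mult_left_mono) auto
    also have "\<dots> = - (c\<^sup>2 / q)"
      using q by (simp add: power2_eq_square field_simps)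
    finally have "c = 0"
      using q by (simp add: divide_le_0_iff)
    then show ?thesis
      by (simp add: c_def)
  qed
  then show ?thesis using that by blast
qed

subsection \<open>Gluing of couplings\<close>

text \<open>The cell of \<open>x\<close> is the index of the first point of a countable dense
  sequence within \<open>e / 2\<close> of \<open>x\<close>; two points of one cell are both that
  close to the same point.\<close>

lemma measurable_small_cells:
  fixes e :: real
  assumes "e > 0"
  obtains q :: "'a::{metric_space, second_countable_topology} \<Rightarrow> nat"
  where "q \<in> borel \<rightarrow>\<^sub>M count_space UNIV" "\<And>x y. q x = q y \<Longrightarrow> dist x y \<le> e"
proof -
  obtain D :: "'a set" where D: "countable D" "\<And>U. open U \<Longrightarrow> U \<noteq> {} \<Longrightarrow> \<exists>d\<in>D. d \<in> U"
    by (rule countable_dense_setE) blast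
  define d where "d = from_nat_into D"
  define q where "q x = (LEAST n. dist (d n) x < e / 2)" for x
  have q: "dist (d (q x)) x < e / 2" for x
  proof -
    obtain z where "z \<in> D" "z \<in> ball x (e / 2)"
      using D(2)[of "ball x (e / 2)"] assms by auto
    then have "dist (d (to_nat_on D z)) x < e / 2"
      using D(1) by (simp add: d_def dist_commute)
    then show ?thesis
      unfolding q_def by (rule LeastI)
  qed
  show ?thesis
  proof
    show "q \<in> borel \<rightarrow>\<^sub>M count_space UNIV"
      unfolding q_def by measurable
    show "dist x y \<le> e" if "q x = q y" for x y
      using q[of x] q[of y] that dist_triangle3[of x y "d (q x)"] by simp
  qed
qed

text \<open>Independent gluing inside each cell of a countable partition avoids disintegration.\<close>
lemma countable_gluing:
  fixes a :: "'a \<Rightarrow> nat" and b :: "'b \<Rightarrow> nat"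
  assumes "prob_space M1" "prob_space M2"
    and [measurable]: "a \<in> M1 \<rightarrow>\<^sub>M count_space UNIV" "b \<in> M2 \<rightarrow>\<^sub>M count_space UNIV"
    and eq: "distr M1 (count_space UNIV) a = distr M2 (count_space UNIV) b"
  obtains G where "sets G = sets (M1 \<Otimes>\<^sub>M M2)" "distr G M1 fst = M1" "distr G M2 snd = M2"
    "AE z in G. a (fst z) = b (snd z)"
proof -
  interpret M1: prob_space M1 by fact
  interpret M2: prob_space M2 by fact
  interpret P: pair_sigma_finite M1 M2 ..
  define N where "N = distr M1 (count_space UNIV) a"
  interpret N: prob_space N
    unfolding N_def by (rule M1.prob_space_distr) measurable
  have [simp]: "sets N = UNIV" by (simp add: N_def)
  \<comment> \<open>\<open>G\<close> has density \<open>w k\<close> on the product of the cells with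
    index \<open>k\<close> and 0 off these products. That product has mass the square of
    \<open>emeasure N {k}\<close>, so dividing once gives it the mass \<open>emeasure N {k}\<close>
    that the marginals require.\<close>
  define w where "w k = inverse (emeasure N {k})" for k
  define g where "g z = (if a (fst z) = b (snd z) then w (a (fst z)) else 0)" for z
  have [measurable]: "g \<in> borel_measurable (M1 \<Otimes>\<^sub>M M2)"
  proof -
    have [measurable]: "w \<in> borel_measurable (count_space UNIV)"
      by simp
    \<comment> \<open>Equality of the two indices is a countable union over their common value
      \<open>k\<close>, a form in which measurability is automatic.\<close>
    have "Measurable.pred (M1 \<Otimes>\<^sub>M M2) (\<lambda>z. \<exists>k. a (fst z) = k \<and> b (snd z) = k)"
      by measurable
    then have [measurable]: "Measurable.pred (M1 \<Otimes>\<^sub>M M2) (\<lambda>z. a (fst z) = b (snd z))"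
      by (simp add: eq_commute)
    show ?thesis
      unfolding g_def by measurable
  qed
  define G where "G = density (M1 \<Otimes>\<^sub>M M2) g"
  \<comment> \<open>For a cell of mass 0 the weight is infinite and the product is 0, not 1; there
    are countably many such cells, so together they are null.\<close>
  have mass: "AE k in N. w k * emeasure N {k} = 1"
  proof -
    have "AE k in N. emeasure N {k} \<noteq> 0"
    proof (rule AE_I')
      show "(\<Union>k\<in>{k. emeasure N {k} = 0}. {k}) \<in> null_sets N"
        by (intro null_sets_UN') auto
    qed auto
    then show ?thesis
    proof eventually_elim
      case (elim k)
      have "emeasure N {k} < \<infinity>"
        using N.emeasure_finite[of "{k}"] by (metis infinity_ennreal_def top.not_eq_extremum)
      then show ?case
        using elim ennreal_divide_self[of "emeasure N {k}"]
        by (simp add: w_def divide_ennreal_def mult.commute)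
    qed
  qed
  have m1: "AE x in M1. w (a x) * emeasure N {a x} = 1"
    using mass unfolding N_def by (subst (asm) AE_distr_iff) auto
  have m2: "AE y in M2. w (b y) * emeasure N {b y} = 1"
    using mass unfolding N_def eq by (subst (asm) AE_distr_iff) auto
  have c1: "emeasure N {k} = emeasure M1 {x \<in> space M1. a x = k}" for k
    unfolding N_def by (subst emeasure_distr) (auto intro!: arg_cong2[where f = emeasure])
  have c2: "emeasure N {k} = emeasure M2 {x \<in> space M2. b x = k}" for k
    unfolding N_def eq by (subst emeasure_distr) (auto intro!: arg_cong2[where f = emeasure])
  show ?thesis
  proof
    show "sets G = sets (M1 \<Otimes>\<^sub>M M2)"
      by (simp add: G_def)
    show "AE z in G. a (fst z) = b (snd z)"
      unfolding G_def by (subst AE_density) (auto simp: g_def)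
    show "distr G M1 fst = M1"
    proof (rule measure_eqI)
      fix A assume "A \<in> sets (distr G M1 fst)"
      then have [measurable]: "A \<in> sets M1" by simp
      have "emeasure (distr G M1 fst) A = (\<integral>\<^sup>+ z. indicator A z \<partial>distr G M1 fst)"
        by simp
      also have "\<dots> = (\<integral>\<^sup>+ z. g z * indicator A (fst z) \<partial>(M1 \<Otimes>\<^sub>M M2))"
        unfolding G_def by (subst nn_integral_distr, simp, simp) (subst nn_integral_density, auto)
      also have "\<dots> = (\<integral>\<^sup>+ x. \<integral>\<^sup>+ y. g (x, y) * indicator A x \<partial>M2 \<partial>M1)"
        by (subst M2.nn_integral_fst[symmetric]) auto
      \<comment> \<open>For fixed \<open>x\<close> the density is constant on the cell of
        \<open>y\<close> with \<open>b y = a x\<close> and 0 elsewhere. By \<open>c2\<close>, hence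
        by equality of the two index laws, this cell has mass \<open>emeasure N {a x}\<close>, which
        cancels the weight.\<close>
      also have "\<dots> = (\<integral>\<^sup>+ x. indicator A x \<partial>M1)"
      proof (rule nn_integral_cong_AE, use m1 in eventually_elim)
        case (elim x)
        have "(\<integral>\<^sup>+ y. g (x, y) * indicator A x \<partial>M2)
            = (\<integral>\<^sup>+ y. (w (a x) * indicator A x) * indicator {y \<in> space M2. b y = a x} y \<partial>M2)"
          by (intro nn_integral_cong) (auto simp: g_def split: split_indicator)
        also have "\<dots> = (w (a x) * indicator A x) * emeasure N {a x}"
          unfolding c2 by (rule nn_integral_cmult_indicator) measurable
        finally show ?case
          using elim by (simp add: ac_simps)
      qed
      finally show "emeasure (distr G M1 fst) A = emeasure M1 A"
        by simp
    qed simp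
    show "distr G M2 snd = M2"
    proof (rule measure_eqI)
      fix A assume "A \<in> sets (distr G M2 snd)"
      then have [measurable]: "A \<in> sets M2" by simp
      have "emeasure (distr G M2 snd) A = (\<integral>\<^sup>+ z. indicator A z \<partial>distr G M2 snd)"
        by simp
      also have "\<dots> = (\<integral>\<^sup>+ z. g z * indicator A (snd z) \<partial>(M1 \<Otimes>\<^sub>M M2))"
        unfolding G_def by (subst nn_integral_distr, simp, simp) (subst nn_integral_density, auto)
      also have "\<dots> = (\<integral>\<^sup>+ y. \<integral>\<^sup>+ x. g (x, y) * indicator A y \<partial>M1 \<partial>M2)"
        by (subst P.nn_integral_snd[symmetric]) auto
      also have "\<dots> = (\<integral>\<^sup>+ y. indicator A y \<partial>M2)"
      proof (rule nn_integral_cong_AE, use m2 in eventually_elim)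
        case (elim y)
        have "(\<integral>\<^sup>+ x. g (x, y) * indicator A y \<partial>M1)
            = (\<integral>\<^sup>+ x. (w (b y) * indicator A y) * indicator {x \<in> space M1. a x = b y} x \<partial>M1)"
          by (intro nn_integral_cong) (auto simp: g_def split: split_indicator)
        also have "\<dots> = (w (b y) * indicator A y) * emeasure N {b y}"
          unfolding c1 by (rule nn_integral_cmult_indicator) measurable
        finally show ?case
          using elim by (simp add: ac_simps)
      qed
      finally show "emeasure (distr G M2 snd) A = emeasure M2 A"
        by simp
    qed simp
  qed
qed

subsection \<open>The Wasserstein distance\<close>

definition transport_cost :: "('a::polish_space \<times> 'a) measure \<Rightarrow> ennreal" where
  "transport_cost \<pi> = (\<integral>\<^sup>+ z. ennreal ((dist (fst z) (snd z))\<^sup>2) \<partial>\<pi>)"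

lemma W2_eq: "W2 \<mu> \<nu> = sqrt (enn2real (INF \<pi>\<in>couplings \<mu> \<nu>. transport_cost \<pi>))"
  by (simp add: W2_def transport_cost_def)

lemma W2_nonneg: "0 \<le> W2 \<mu> \<nu>"
  by (simp add: W2_def)

lemma borel_measurable_fst_snd [measurable]:
  "fst \<in> (borel :: ('a::topological_space \<times> 'b::topological_space) measure) \<rightarrow>\<^sub>M borel"
  "snd \<in> (borel :: ('a::topological_space \<times> 'b::topological_space) measure) \<rightarrow>\<^sub>M borel"
  by (auto intro!: borel_measurable_continuous_onI continuous_intros)

lemma P2_D:
  assumes "\<mu> \<in> P2"
  shows "prob_space \<mu>" "sets \<mu> = sets borel"
  using assms by (auto simp: P2_def)

lemma couplings_D:
  assumes "\<pi> \<in> couplings \<mu> \<nu>"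
  shows "prob_space \<pi>" "sets \<pi> = sets borel" "distr \<pi> borel fst = \<mu>" "distr \<pi> borel snd = \<nu>"
  using assms by (auto simp: couplings_def)

text \<open>This domination makes a finite second moment independent of the base point and gives
  every coupling of measures in \<open>P2\<close> a finite cost.\<close>

lemma square_dist_le:
  fixes x y z :: "'a::metric_space"
  shows "(dist x z)\<^sup>2 \<le> 2 * (dist y x)\<^sup>2 + 2 * (dist y z)\<^sup>2"
proof -
  have "(dist x z)\<^sup>2 \<le> (dist y x + dist y z)\<^sup>2"
    using dist_triangle3[of x z y] by (intro power_mono) (auto simp: dist_commute)
  also have "\<dots> \<le> 2 * (dist y x)\<^sup>2 + 2 * (dist y z)\<^sup>2"
    using sum_squares_bound[of "dist y x" "dist y z"] by (simp add: power2_sum)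
  finally show ?thesis .
qed

lemma P2_integrable_square_dist:
  assumes "\<mu> \<in> P2"
  shows "integrable \<mu> (\<lambda>x. (dist x0 x)\<^sup>2)"
proof -
  interpret prob_space \<mu> by (rule P2_D(1)[OF assms])
  note [measurable_cong] = P2_D(2)[OF assms]
  obtain y where y: "(\<integral>\<^sup>+ x. ennreal ((dist y x)\<^sup>2) \<partial>\<mu>) < \<infinity>"
    using assms by (auto simp: P2_def)
  have "integrable \<mu> (\<lambda>x. (dist y x)\<^sup>2)"
    using y by (intro integrableI_nonneg) auto
  then have "integrable \<mu> (\<lambda>x. 2 * (dist y x0)\<^sup>2 + 2 * (dist y x)\<^sup>2)"
    by simp
  then show ?thesis
    by (rule Bochner_Integration.integrable_bound) (use square_dist_le in auto)
qed

lemma coupling_integrable: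
  fixes f :: "'a::polish_space \<Rightarrow> real"
  assumes \<pi>: "\<pi> \<in> couplings \<mu> \<nu>" and [measurable]: "f \<in> borel_measurable borel"
  shows "integrable \<mu> f \<Longrightarrow> integrable \<pi> (\<lambda>z. f (fst z))"
    and "integrable \<nu> f \<Longrightarrow> integrable \<pi> (\<lambda>z. f (snd z))"
    and "(\<integral>z. f (fst z) \<partial>\<pi>) = (\<integral>x. f x \<partial>\<mu>)"
    and "(\<integral>z. f (snd z) \<partial>\<pi>) = (\<integral>x. f x \<partial>\<nu>)"
proof -
  note [measurable_cong] = couplings_D(2)[OF \<pi>]
  show "integrable \<mu> f \<Longrightarrow> integrable \<pi> (\<lambda>z. f (fst z))"
    by (rule integrable_distr[where M' = borel]) (use couplings_D(3)[OF \<pi>] in auto)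
  show "integrable \<nu> f \<Longrightarrow> integrable \<pi> (\<lambda>z. f (snd z))"
    by (rule integrable_distr[where M' = borel]) (use couplings_D(4)[OF \<pi>] in auto)
  show "(\<integral>z. f (fst z) \<partial>\<pi>) = (\<integral>x. f x \<partial>\<mu>)"
    unfolding couplings_D(3)[OF \<pi>, symmetric] by (rule integral_distr[symmetric]) auto
  show "(\<integral>z. f (snd z) \<partial>\<pi>) = (\<integral>x. f x \<partial>\<nu>)"
    unfolding couplings_D(4)[OF \<pi>, symmetric] by (rule integral_distr[symmetric]) auto
qed

lemma coupling_integrable_square_dist:
  fixes \<mu> \<nu> :: "'a::polish_space measure"
  assumes "\<mu> \<in> P2" "\<nu> \<in> P2" and \<pi>: "\<pi> \<in> couplings \<mu> \<nu>"
  shows "integrable \<pi> (\<lambda>z. (dist (fst z) (snd z))\<^sup>2)"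
proof -
  note [measurable_cong] = couplings_D(2)[OF \<pi>]
  fix y :: 'a
  have "integrable \<pi> (\<lambda>z. (dist y (fst z))\<^sup>2)" "integrable \<pi> (\<lambda>z. (dist y (snd z))\<^sup>2)"
    using assms by (auto intro!: coupling_integrable[OF \<pi>] P2_integrable_square_dist)
  then have "integrable \<pi> (\<lambda>z. 2 * (dist y (fst z))\<^sup>2 + 2 * (dist y (snd z))\<^sup>2)"
    by simp
  then show ?thesis
    by (rule Bochner_Integration.integrable_bound) (use square_dist_le in auto)
qed

text \<open>Passing to a real integral allows signed cross terms to be split off later.\<close>

lemma coupling_transport_cost:
  assumes "\<mu> \<in> P2" "\<nu> \<in> P2" "\<pi> \<in> couplings \<mu> \<nu>"
  shows "transport_cost \<pi> = ennreal (\<integral>z. (dist (fst z) (snd z))\<^sup>2 \<partial>\<pi>)"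
  unfolding transport_cost_def
  by (intro nn_integral_eq_integral coupling_integrable_square_dist[OF assms]) auto

lemma couplings_nonempty:
  assumes "prob_space \<mu>" "sets \<mu> = sets borel" "prob_space \<nu>" "sets \<nu> = sets borel"
  shows "couplings \<mu> \<nu> \<noteq> {}"
proof -
  interpret M: prob_space \<mu> by fact
  interpret N: prob_space \<nu> by fact
  \<comment> \<open>Constant cell indices impose no constraint, so the gluing is just the product
    measure.\<close>
  obtain G where G: "sets G = sets (\<mu> \<Otimes>\<^sub>M \<nu>)" "distr G \<mu> fst = \<mu>" "distr G \<nu> snd = \<nu>"
    by (rule countable_gluing[OF assms(1,3), of "\<lambda>_. 0" "\<lambda>_. 0"])
      (simp_all add: M.distr_const N.distr_const)
  note [measurable_cong] = G(1)
  have "prob_space G"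
    using assms(1) by (intro prob_space_distrD[of fst G \<mu>]) (auto simp: G(2))
  moreover have "sets G = sets borel"
    using sets_pair_measure_cong[OF assms(2,4)] G(1) unfolding borel_prod by simp
  moreover have "distr G borel fst = distr G \<mu> fst" "distr G borel snd = distr G \<nu> snd"
    using assms(2,4) by (auto intro: distr_cong)
  then have "distr G borel fst = \<mu>" "distr G borel snd = \<nu>"
    unfolding G(2,3) .
  ultimately have "G \<in> couplings \<mu> \<nu>"
    unfolding couplings_def by blast
  then show ?thesis by blast
qed

lemma W2_le:
  assumes "\<pi> \<in> couplings \<mu> \<nu>" "transport_cost \<pi> \<le> ennreal (a\<^sup>2)" "0 \<le> a"
  shows "W2 \<mu> \<nu> \<le> a"
proof -
  have "(INF \<pi>\<in>couplings \<mu> \<nu>. transport_cost \<pi>) \<le> ennreal (a\<^sup>2)"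
    using assms by (meson INF_lower2)
  then have "enn2real (INF \<pi>\<in>couplings \<mu> \<nu>. transport_cost \<pi>) \<le> a\<^sup>2"
    by (simp add: enn2real_leI)
  then show ?thesis
    unfolding W2_eq using assms(3) by (simp add: real_le_lsqrt)
qed

text \<open>Since \<open>enn2real\<close> sends infinity to 0, a small \<open>W2\<close> says
  something about the infimum only once the infimum is known to be finite; this is why a coupling of
  finite cost is produced beforehand.\<close>

lemma W2_lessE:
  assumes "\<mu> \<in> P2" "\<nu> \<in> P2" "W2 \<mu> \<nu> < a"
  obtains \<pi> where "\<pi> \<in> couplings \<mu> \<nu>" "transport_cost \<pi> < ennreal (a\<^sup>2)"
proof -
  define I where "I = (INF \<pi>\<in>couplings \<mu> \<nu>. transport_cost \<pi>)"
  obtain \<pi> where \<pi>: "\<pi> \<in> couplings \<mu> \<nu>"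
    using couplings_nonempty[OF P2_D[OF assms(1)] P2_D[OF assms(2)]] by blast
  have "I \<le> transport_cost \<pi>"
    unfolding I_def by (rule INF_lower) (rule \<pi>)
  also have "\<dots> < top"
    by (simp add: coupling_transport_cost[OF assms(1,2) \<pi>])
  finally have fin: "I < top" .
  have "sqrt (enn2real I) < a"
    using assms(3) by (simp add: W2_eq I_def)
  then have "enn2real I < a\<^sup>2"
    by (metis enn2real_nonneg power_strict_mono real_sqrt_ge_zero real_sqrt_pow2 zero_less_numeral)
  then have "I < ennreal (a\<^sup>2)"
    using fin by (metis enn2real_nonneg ennreal_enn2real ennreal_less_iff)
  then show ?thesis
    unfolding I_def INF_less_iff using that by blast
qed

lemma distr_couplings:
  assumes \<pi>: "\<pi> \<in> couplings \<mu> \<nu>"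
    and [measurable]: "s \<in> borel \<rightarrow>\<^sub>M borel" "t \<in> borel \<rightarrow>\<^sub>M borel"
  shows "distr \<pi> borel (\<lambda>z. (s (fst z), t (snd z))) \<in> couplings (distr \<mu> borel s) (distr \<nu> borel t)"
    and "transport_cost (distr \<pi> borel (\<lambda>z. (s (fst z), t (snd z))))
      = (\<integral>\<^sup>+ z. ennreal ((dist (s (fst z)) (t (snd z)))\<^sup>2) \<partial>\<pi>)"
proof -
  note [measurable_cong] = couplings_D(2)[OF \<pi>]
  note m = couplings_D(3,4)[OF \<pi>, symmetric]
  interpret prob_space \<pi> by (rule couplings_D(1)[OF \<pi>])
  have [measurable]: "(\<lambda>z. (s (fst z), t (snd z))) \<in> \<pi> \<rightarrow>\<^sub>M borel"
    by (rule borel_measurable_Pair) auto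
  show "distr \<pi> borel (\<lambda>z. (s (fst z), t (snd z))) \<in> couplings (distr \<mu> borel s) (distr \<nu> borel t)"
    unfolding couplings_def m by (auto simp: distr_distr comp_def intro!: prob_space_distr)
  show "transport_cost (distr \<pi> borel (\<lambda>z. (s (fst z), t (snd z))))
      = (\<integral>\<^sup>+ z. ennreal ((dist (s (fst z)) (t (snd z)))\<^sup>2) \<partial>\<pi>)"
    unfolding transport_cost_def by (subst nn_integral_distr) auto
qed

section \<open>Metric axioms for the Wasserstein distance\<close>

lemma W2_commute: "W2 \<mu> \<nu> = W2 \<nu> \<mu>"
proof -
  have swap: "\<exists>\<pi>'\<in>couplings \<nu> \<mu>. transport_cost \<pi>' \<le> transport_cost \<pi>"
    if \<pi>: "\<pi> \<in> couplings \<mu> \<nu>" for \<mu> \<nu> and \<pi> :: "('a \<times> 'a) measure"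
  proof
    note [measurable_cong] = couplings_D(2)[OF \<pi>]
    note m = couplings_D(3,4)[OF \<pi>, symmetric]
    interpret prob_space \<pi> by (rule couplings_D(1)[OF \<pi>])
    have [measurable]: "(\<lambda>z. (snd z, fst z)) \<in> \<pi> \<rightarrow>\<^sub>M borel"
      by (rule borel_measurable_Pair) auto
    show "distr \<pi> borel (\<lambda>z. (snd z, fst z)) \<in> couplings \<nu> \<mu>"
      unfolding couplings_def m by (auto simp: distr_distr comp_def intro!: prob_space_distr)
    show "transport_cost (distr \<pi> borel (\<lambda>z. (snd z, fst z))) \<le> transport_cost \<pi>"
      unfolding transport_cost_def by (subst nn_integral_distr) (auto simp: dist_commute)
  qed
  have "(INF \<pi>\<in>couplings \<mu> \<nu>. transport_cost \<pi>) = (INF \<pi>\<in>couplings \<nu> \<mu>. transport_cost \<pi>)"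
    by (intro antisym INF_mono swap)
  then show ?thesis
    by (simp add: W2_eq)
qed

lemma W2_self:
  assumes "\<mu> \<in> P2"
  shows "W2 \<mu> \<mu> = 0"
proof -
  interpret prob_space \<mu> by (rule P2_D(1)[OF assms])
  note [measurable_cong] = P2_D(2)[OF assms]
  have [measurable]: "(\<lambda>x. (x, x)) \<in> \<mu> \<rightarrow>\<^sub>M borel"
    by (rule borel_measurable_Pair) auto
  have "distr \<mu> borel (\<lambda>x. x) = \<mu>"
    by (rule distr_id2) (simp add: P2_D(2)[OF assms])
  then have "distr \<mu> borel (\<lambda>x. (x, x)) \<in> couplings \<mu> \<mu>"
    unfolding couplings_def by (auto simp: distr_distr comp_def intro!: prob_space_distr)
  moreover have "transport_cost (distr \<mu> borel (\<lambda>x. (x, x))) = 0"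
    unfolding transport_cost_def by (subst nn_integral_distr) auto
  ultimately show ?thesis
    using W2_le[of _ \<mu> \<mu> 0] W2_nonneg[of \<mu> \<mu>] by (metis antisym order_refl zero_le)
qed

text \<open>By Markov's inequality a cheap coupling moves little mass farther than
  \<open>inverse (Suc n)\<close>, so nearly all of the mass of \<open>C\<close> lands in the
  neighbourhood \<open>U n\<close>. These neighbourhoods shrink to \<open>C\<close> because
  \<open>C\<close> is closed.\<close>

lemma W2_eq_0_emeasure_closed_le:
  fixes \<mu> \<nu> :: "'a::polish_space measure"
  assumes P2: "\<mu> \<in> P2" "\<nu> \<in> P2" and W0: "W2 \<mu> \<nu> = 0" and C: "closed C"
  shows "emeasure \<mu> C \<le> emeasure \<nu> C"
\<comment> \<open>\<open>infdist\<close> to the empty set is 0 by convention, so each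
  \<open>U n\<close> would then be the whole space.\<close>
proof (cases "C = {}")
  case False
  interpret N: prob_space \<nu> by (rule P2_D(1)[OF P2(2)])
  define U where "U n = {x. infdist x C \<le> inverse (real (Suc n))}" for n
  have U_closed: "closed (U n)" for n
    unfolding U_def by (intro closed_Collect_le continuous_intros)
  have [measurable]: "C \<in> sets borel" "\<And>n. U n \<in> sets borel"
    using C U_closed by auto
  have le: "emeasure \<mu> C \<le> emeasure \<nu> (U n)" for n
  proof (rule ennreal_le_epsilon)
    fix e :: real assume e: "0 < e"
    \<comment> \<open>Chosen so that the Markov bound, \<open>(Suc n)\<close> squared times the cost
      bound, is exactly \<open>e\<close>.\<close>
    define a where "a = sqrt e * inverse (real (Suc n))"
    have a: "a > 0" "(real (Suc n))\<^sup>2 * a\<^sup>2 = e"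
      using e by (auto simp: a_def power_mult_distrib power_inverse simp del: of_nat_Suc)
    then obtain \<pi> where \<pi>: "\<pi> \<in> couplings \<mu> \<nu>" "transport_cost \<pi> < ennreal (a\<^sup>2)"
      using W2_lessE[OF P2, of a] W0 by auto
    note [measurable_cong] = couplings_D(2)[OF \<pi>(1)]
    have [simp]: "space \<pi> = UNIV"
      using sets_eq_imp_space_eq[OF couplings_D(2)[OF \<pi>(1)]] by simp
    \<comment> \<open>The pairs at distance at least \<open>inverse (Suc n)\<close>, written in the
      form to which Markov's inequality applies.\<close>
    define F :: "('a \<times> 'a) set" where "F = {z. 1 \<le> ennreal ((real (Suc n))\<^sup>2) * ennreal ((dist (fst z) (snd z))\<^sup>2)}"
    have [measurable]: "F \<in> sets \<pi>"
      unfolding F_def by measurable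
    have [measurable]: "snd -` U n \<in> sets \<pi>"
      using measurable_sets[of snd \<pi> borel "U n"] by simp
    have "z \<in> F" if "z \<notin> snd -` U n" "fst z \<in> C" for z
    proof -
      have "inverse (real (Suc n)) < dist (fst z) (snd z)"
        using that infdist_le[of "fst z" C "snd z"] by (auto simp: U_def dist_commute)
      then have "1 \<le> real (Suc n) * dist (fst z) (snd z)"
        by (simp add: field_simps)
      then have "1 \<le> (real (Suc n) * dist (fst z) (snd z))\<^sup>2"
        by (rule one_le_power)
      then show ?thesis
        by (simp add: F_def power_mult_distrib ennreal_mult[symmetric] del: of_nat_Suc)
    qed
    then have sub: "fst -` C \<subseteq> snd -` U n \<union> F"
      by auto
    have "emeasure \<mu> C = emeasure \<pi> (fst -` C)"
      unfolding couplings_D(3)[OF \<pi>(1), symmetric] by (subst emeasure_distr) auto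
    also have "\<dots> \<le> emeasure \<pi> (snd -` U n \<union> F)"
      using sub by (intro emeasure_mono) auto
    also have "\<dots> \<le> emeasure \<pi> (snd -` U n) + emeasure \<pi> F"
      by (intro emeasure_subadditive) auto
    also have "emeasure \<pi> (snd -` U n) = emeasure \<nu> (U n)"
      unfolding couplings_D(4)[OF \<pi>(1), symmetric] by (subst emeasure_distr) auto
    also have "emeasure \<pi> F \<le> ennreal ((real (Suc n))\<^sup>2) * transport_cost \<pi>"
      using nn_integral_Markov_inequality[where M = \<pi> and A = UNIV and c = "ennreal ((real (Suc n))\<^sup>2)"
          and u = "\<lambda>z. ennreal ((dist (fst z) (snd z))\<^sup>2)"]
      by (simp add: F_def transport_cost_def)
    also have "\<dots> \<le> ennreal ((real (Suc n))\<^sup>2) * ennreal (a\<^sup>2)"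
      using \<pi>(2) by (intro mult_left_mono) auto
    also have "\<dots> = ennreal e"
      using a by (simp add: ennreal_mult[symmetric] del: of_nat_Suc)
    finally show "emeasure \<mu> C \<le> emeasure \<nu> (U n) + ennreal e"
      by (simp add: add_left_mono)
  qed
  have "(\<Inter>n. U n) = C"
  proof -
    have "x \<in> C" if "x \<in> (\<Inter>n. U n)" for x
    proof (rule ccontr)
      assume "x \<notin> C"
      then have "infdist x C > 0"
        using C False by (intro infdist_pos_not_in_closed)
      then obtain n where "inverse (real (Suc n)) < infdist x C"
        using reals_Archimedean by blast
      with that show False
        by (auto simp: U_def not_less[symmetric] simp del: of_nat_Suc)
    qed
    moreover have "C \<subseteq> U n" for n
      by (auto simp: U_def)
    ultimately show ?thesis
      by blast
  qed
  moreover have "decseq U"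
    unfolding decseq_def U_def
    by (intro allI impI subsetI CollectI) (erule CollectE, erule order_trans, simp)
  then have "(INF n. emeasure \<nu> (U n)) = emeasure \<nu> (\<Inter>n. U n)"
    by (intro INF_emeasure_decseq) (auto simp: P2_D(2)[OF P2(2)])
  ultimately show ?thesis
    using le by (metis INF_greatest)
qed simp

text \<open>Closed sets are stable under intersection and generate the Borel sets, so the inequality
  on closed sets, used in both directions, identifies the measures.\<close>

lemma W2_eq_0_iff:
  assumes "\<mu> \<in> P2" "\<nu> \<in> P2"
  shows "W2 \<mu> \<nu> = 0 \<longleftrightarrow> \<mu> = \<nu>"
proof
  assume W0: "W2 \<mu> \<nu> = 0"
  interpret prob_space \<mu> by (rule P2_D(1)[OF assms(1)])
  show "\<mu> = \<nu>"
  proof (rule measure_eqI_generator_eq)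
    show "Int_stable (Collect closed)"
      by (auto simp: Int_stable_def)
    show "emeasure \<mu> X = emeasure \<nu> X" if "X \<in> Collect closed" for X
      using that assms W0 W2_commute[of \<mu> \<nu>]
      by (intro antisym W2_eq_0_emeasure_closed_le) auto
    show "sets \<mu> = sigma_sets UNIV (Collect closed)" "sets \<nu> = sigma_sets UNIV (Collect closed)"
      using assms by (auto simp: P2_D borel_eq_closed)
    show "range (\<lambda>_. UNIV) \<subseteq> Collect closed"
      by auto
  qed auto
qed (use assms W2_self in auto)

text \<open>Cauchy-Schwarz in a form linear in the squares, which can be integrated term by term;
  the defect is a perfect square. With suitable weights it does the work of Minkowski's
  inequality.\<close>

lemma weighted_square_sum:
  fixes x y p q :: real
  assumes "p > 0" "q > 0"
  shows "(x + y)\<^sup>2 \<le> (p + q) * (x\<^sup>2 / p + y\<^sup>2 / q)"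
proof -
  have "(p + q) * (x\<^sup>2 / p + y\<^sup>2 / q) - (x + y)\<^sup>2 = (x * q - y * p)\<^sup>2 / (p * q)"
    using assms by (simp add: field_simps power2_eq_square)
  also have "\<dots> \<ge> 0"
    using assms by simp
  finally show ?thesis by simp
qed

lemma weighted_square_sum3:
  fixes x y z p q r :: real
  assumes "p > 0" "q > 0" "r > 0"
  shows "(x + y + z)\<^sup>2 \<le> (p + q + r) * (x\<^sup>2 / p + y\<^sup>2 / q + z\<^sup>2 / r)"
proof -
  have "(x + y + z)\<^sup>2 \<le> (p + q + r) * ((x + y)\<^sup>2 / (p + q) + z\<^sup>2 / r)"
    using assms by (intro weighted_square_sum) auto
  also have "(x + y)\<^sup>2 / (p + q) \<le> x\<^sup>2 / p + y\<^sup>2 / q"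
    using assms weighted_square_sum[of p q x y] by (simp add: pos_divide_le_eq mult.commute)
  finally show ?thesis
    using assms by (simp add: mult_left_mono add_right_mono)
qed

text \<open>The couplings are glued along small cells of the middle space: their middle points need
  not coincide, but lie within \<open>e\<close> of each other, and this gap becomes a third leg in
  the triangle inequality.\<close>

lemma coupling_composition:
  fixes \<mu> \<nu> \<rho> :: "'a::polish_space measure"
  assumes \<pi>1: "\<pi>1 \<in> couplings \<mu> \<nu>" "transport_cost \<pi>1 \<le> ennreal (a\<^sup>2)"
    and \<pi>2: "\<pi>2 \<in> couplings \<nu> \<rho>" "transport_cost \<pi>2 \<le> ennreal (b\<^sup>2)"
    and pos: "a > 0" "b > 0" "e > 0"
  obtains \<pi> where "\<pi> \<in> couplings \<mu> \<rho>" "transport_cost \<pi> \<le> ennreal ((a + e + b)\<^sup>2)"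
proof -
  interpret P1: prob_space \<pi>1 by (rule couplings_D(1)[OF \<pi>1(1)])
  interpret P2: prob_space \<pi>2 by (rule couplings_D(1)[OF \<pi>2(1)])
  note [measurable_cong] = couplings_D(2)[OF \<pi>1(1)] couplings_D(2)[OF \<pi>2(1)]
  obtain q :: "'a \<Rightarrow> nat" where q [measurable]: "q \<in> borel \<rightarrow>\<^sub>M count_space UNIV"
    and small: "\<And>x y. q x = q y \<Longrightarrow> dist x y \<le> e"
    using measurable_small_cells[OF \<open>e > 0\<close>] by blast
  \<comment> \<open>Both index laws are the image of the common marginal \<nu> under
    \<open>q\<close>, as gluing requires.\<close>
  have "distr \<pi>1 (count_space UNIV) (\<lambda>z. q (snd z)) = distr (distr \<pi>1 borel snd) (count_space UNIV) q"
    by (simp add: distr_distr comp_def)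
  also have "\<dots> = distr (distr \<pi>2 borel fst) (count_space UNIV) q"
    by (simp add: couplings_D(4)[OF \<pi>1(1)] couplings_D(3)[OF \<pi>2(1)])
  also have "\<dots> = distr \<pi>2 (count_space UNIV) (\<lambda>z. q (fst z))"
    by (simp add: distr_distr comp_def)
  finally obtain G where G: "sets G = sets (\<pi>1 \<Otimes>\<^sub>M \<pi>2)" "distr G \<pi>1 fst = \<pi>1" "distr G \<pi>2 snd = \<pi>2"
    "AE z in G. q (snd (fst z)) = q (fst (snd z))"
    using countable_gluing[of \<pi>1 \<pi>2 "\<lambda>z. q (snd z)" "\<lambda>z. q (fst z)"]
      P1.prob_space_axioms P2.prob_space_axioms by auto
  note [measurable_cong] = G(1)
  interpret G: prob_space G
    using P1.prob_space_axioms by (intro prob_space_distrD[of fst G \<pi>1]) (auto simp: G(2))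
  define \<pi> where "\<pi> = distr G borel (\<lambda>z. (fst (fst z), snd (snd z)))"
  have [measurable]: "(\<lambda>z. (fst (fst z), snd (snd z))) \<in> G \<rightarrow>\<^sub>M borel"
    by (rule borel_measurable_Pair) measurable
  have "distr \<pi> borel fst = distr (distr G \<pi>1 fst) borel fst"
    unfolding \<pi>_def by (simp add: distr_distr comp_def)
  moreover have "distr \<pi> borel snd = distr (distr G \<pi>2 snd) borel snd"
    unfolding \<pi>_def by (simp add: distr_distr comp_def)
  ultimately have "\<pi> \<in> couplings \<mu> \<rho>"
    unfolding couplings_def
    using couplings_D(3)[OF \<pi>1(1)] couplings_D(4)[OF \<pi>2(1)]
    by (auto simp: G \<pi>_def intro!: G.prob_space_distr)
  moreover have "transport_cost \<pi> \<le> ennreal ((a + e + b)\<^sup>2)"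
  proof -
    define s where "s = a + e + b"
    have s: "s > 0" using pos by (simp add: s_def)
    have "transport_cost \<pi> = (\<integral>\<^sup>+ z. ennreal ((dist (fst (fst z)) (snd (snd z)))\<^sup>2) \<partial>G)"
      unfolding transport_cost_def \<pi>_def by (subst nn_integral_distr) auto
    also have "\<dots> \<le> (\<integral>\<^sup>+ z. ennreal (s / a) * ennreal ((dist (fst (fst z)) (snd (fst z)))\<^sup>2) + ennreal (s * e)
        + ennreal (s / b) * ennreal ((dist (fst (snd z)) (snd (snd z)))\<^sup>2) \<partial>G)"
    proof (rule nn_integral_mono_AE, use G(4) in eventually_elim)
      case (elim z)
      define A where "A = dist (fst (fst z)) (snd (fst z))"
      define B where "B = dist (fst (snd z)) (snd (snd z))"
      have "dist (fst (fst z)) (snd (snd z)) \<le> A + dist (snd (fst z)) (fst (snd z)) + B"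
        unfolding A_def B_def by (meson add_mono_thms_linordered_semiring(3) dist_triangle order_trans)
      also have "\<dots> \<le> A + e + B"
        using small[OF elim] by simp
      finally have "(dist (fst (fst z)) (snd (snd z)))\<^sup>2 \<le> (A + e + B)\<^sup>2"
        by (intro power_mono) auto
      \<comment> \<open>The weights are the bounds \<open>a\<close>, \<open>e\<close>,
        \<open>b\<close> themselves; after integration the three terms are at most
        \<open>s * a\<close>, \<open>s * e\<close> and \<open>s * b\<close>, with sum exactly
        \<open>s\<close> squared.\<close>
      also have "\<dots> \<le> s * (A\<^sup>2 / a + e\<^sup>2 / e + B\<^sup>2 / b)"
        unfolding s_def using pos by (intro weighted_square_sum3) auto
      also have "\<dots> = s / a * A\<^sup>2 + s * e + s / b * B\<^sup>2"
        using pos by (simp add: field_simps power2_eq_square)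
      finally show ?case
        using s pos unfolding A_def[symmetric] B_def[symmetric]
        by (simp add: ennreal_mult[symmetric] ennreal_plus[symmetric] ennreal_leI del: ennreal_plus)
    qed
    also have "\<dots> = ennreal (s / a) * (\<integral>\<^sup>+ z. ennreal ((dist (fst (fst z)) (snd (fst z)))\<^sup>2) \<partial>G) + ennreal (s * e)
        + ennreal (s / b) * (\<integral>\<^sup>+ z. ennreal ((dist (fst (snd z)) (snd (snd z)))\<^sup>2) \<partial>G)"
      by (simp add: nn_integral_add nn_integral_cmult G.emeasure_space_1)
    also have "(\<integral>\<^sup>+ z. ennreal ((dist (fst (fst z)) (snd (fst z)))\<^sup>2) \<partial>G) = transport_cost \<pi>1"
      unfolding transport_cost_def
      by (subst nn_integral_distr[of fst G \<pi>1, unfolded G(2)]) auto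
    also have "(\<integral>\<^sup>+ z. ennreal ((dist (fst (snd z)) (snd (snd z)))\<^sup>2) \<partial>G) = transport_cost \<pi>2"
      unfolding transport_cost_def
      by (subst nn_integral_distr[of snd G \<pi>2, unfolded G(3)]) auto
    also have "ennreal (s / a) * transport_cost \<pi>1 + ennreal (s * e) + ennreal (s / b) * transport_cost \<pi>2
        \<le> ennreal (s / a) * ennreal (a\<^sup>2) + ennreal (s * e) + ennreal (s / b) * ennreal (b\<^sup>2)"
      using \<pi>1(2) \<pi>2(2) by (intro add_mono mult_left_mono) auto
    also have "\<dots> = ennreal (s / a * a\<^sup>2 + s * e + s / b * b\<^sup>2)"
      using s pos by (simp add: ennreal_mult[symmetric] ennreal_plus[symmetric] del: ennreal_plus)
    also have "s / a * a\<^sup>2 + s * e + s / b * b\<^sup>2 = (a + e + b)\<^sup>2"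
      using pos by (simp add: s_def field_simps power2_eq_square)
    finally show ?thesis .
  qed
  ultimately show ?thesis
    using that by blast
qed

lemma W2_triangle:
  assumes "\<mu> \<in> P2" "\<nu> \<in> P2" "\<rho> \<in> P2"
  shows "W2 \<mu> \<rho> \<le> W2 \<mu> \<nu> + W2 \<nu> \<rho>"
proof (rule field_le_epsilon)
  fix e :: real assume "0 < e"
  then have e: "e / 3 > 0" by simp
  \<comment> \<open>One third of \<open>e\<close> goes to each near-minimal coupling and one to the
    cell size; it also keeps \<open>a\<close> and \<open>b\<close> positive when a distance is
    0.\<close>
  define a where "a = W2 \<mu> \<nu> + e / 3"
  define b where "b = W2 \<nu> \<rho> + e / 3"
  have ab: "W2 \<mu> \<nu> < a" "W2 \<nu> \<rho> < b" "a > 0" "b > 0"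
    using e W2_nonneg[of \<mu> \<nu>] W2_nonneg[of \<nu> \<rho>] by (auto simp: a_def b_def)
  obtain \<pi>1 where \<pi>1: "\<pi>1 \<in> couplings \<mu> \<nu>" "transport_cost \<pi>1 < ennreal (a\<^sup>2)"
    using W2_lessE[OF assms(1,2) ab(1)] .
  obtain \<pi>2 where \<pi>2: "\<pi>2 \<in> couplings \<nu> \<rho>" "transport_cost \<pi>2 < ennreal (b\<^sup>2)"
    using W2_lessE[OF assms(2,3) ab(2)] .
  obtain \<pi> where "\<pi> \<in> couplings \<mu> \<rho>" "transport_cost \<pi> \<le> ennreal ((a + e / 3 + b)\<^sup>2)"
    using coupling_composition[OF \<pi>1(1) less_imp_le[OF \<pi>1(2)] \<pi>2(1) less_imp_le[OF \<pi>2(2)] ab(3,4) e] .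
  then have "W2 \<mu> \<rho> \<le> a + e / 3 + b"
    using ab e by (intro W2_le) auto
  then show "W2 \<mu> \<rho> \<le> W2 \<mu> \<nu> + W2 \<nu> \<rho> + e"
    by (simp add: a_def b_def)
qed

lemma Metric_space_P2: "Metric_space P2 W2"
  by (intro Metric_space.intro W2_nonneg W2_commute W2_eq_0_iff W2_triangle)

subsection \<open>Translations along a Hilbert factor\<close>

text \<open>What remains of the decomposition of the space once the other factor is forgotten:
  \<open>p\<close> is the Hilbert component, and the formula in \<open>dist_translate\<close> is the
  product distance with the square of \<open>(p x + v) - (p y + w)\<close> expanded.\<close>

locale hilbert_translations =
  fixes p :: "'a::polish_space \<Rightarrow> 'h::{real_inner, polish_space}"
    and \<tau> :: "'h \<Rightarrow> 'a \<Rightarrow> 'a"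
  assumes dist_translate: "(dist (\<tau> v x) (\<tau> w y))\<^sup>2
      = (dist x y)\<^sup>2 + 2 * inner (p x - p y) (v - w) + (norm (v - w))\<^sup>2"
    and translate_translate: "\<tau> v (\<tau> w x) = \<tau> (v + w) x"
    and translate_0: "\<tau> 0 x = x"
    and p_translate: "p (\<tau> v x) = p x + v"
    and norm_p_diff: "norm (p x - p y) \<le> dist x y"
begin

lemma isometry_translate: "dist (\<tau> v x) (\<tau> v y) = dist x y"
  using dist_translate[of v x v y] by simp

lemma measurable_p [measurable]: "p \<in> borel \<rightarrow>\<^sub>M borel"
proof -
  have "1-lipschitz_on UNIV p"
    by (intro lipschitz_onI) (use norm_p_diff in \<open>auto simp: dist_norm\<close>)
  then show ?thesis
    by (intro borel_measurable_continuous_onI lipschitz_on_continuous_on)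
qed

lemma measurable_translate [measurable]: "\<tau> v \<in> borel \<rightarrow>\<^sub>M borel"
proof -
  have "1-lipschitz_on UNIV (\<tau> v)"
    by (intro lipschitz_onI) (auto simp: isometry_translate)
  then show ?thesis
    by (intro borel_measurable_continuous_onI lipschitz_on_continuous_on)
qed

definition translate_measure :: "'h \<Rightarrow> 'a measure \<Rightarrow> 'a measure" where
  "translate_measure v \<mu> = distr \<mu> borel (\<tau> v)"

lemma translate_measure_P2:
  assumes "\<mu> \<in> P2"
  shows "translate_measure v \<mu> \<in> P2"
proof -
  interpret prob_space \<mu> by (rule P2_D(1)[OF assms])
  note [measurable_cong] = P2_D(2)[OF assms]
  obtain y where y: "(\<integral>\<^sup>+ x. ennreal ((dist y x)\<^sup>2) \<partial>\<mu>) < \<infinity>"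
    using assms by (auto simp: P2_def)
  have "(\<integral>\<^sup>+ x. ennreal ((dist (\<tau> v y) x)\<^sup>2) \<partial>translate_measure v \<mu>) < \<infinity>"
    using y unfolding translate_measure_def
    by (subst nn_integral_distr) (auto simp: isometry_translate)
  then show ?thesis
    unfolding P2_def by (auto simp: translate_measure_def intro!: prob_space_distr)
qed

lemma translate_measure_add:
  assumes "\<mu> \<in> P2"
  shows "translate_measure v (translate_measure w \<mu>) = translate_measure (v + w) \<mu>"
proof -
  note [measurable_cong] = P2_D(2)[OF assms]
  show ?thesis
    unfolding translate_measure_def by (simp add: distr_distr comp_def translate_translate)
qed

lemma translate_measure_0:
  assumes "\<mu> \<in> P2"
  shows "translate_measure 0 \<mu> = \<mu>"
  unfolding translate_measure_def translate_0 by (rule distr_id2) (simp add: P2_D(2)[OF assms])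

lemma integrable_inner_p:
  assumes "\<mu> \<in> P2"
  shows "integrable \<mu> (\<lambda>x. norm (p x))" "integrable \<mu> (\<lambda>x. inner (p x) w)"
proof -
  interpret prob_space \<mu> by (rule P2_D(1)[OF assms])
  note [measurable_cong] = P2_D(2)[OF assms]
  fix y :: 'a
  have p_le: "norm (p x) \<le> norm (p y) + 1 + (dist y x)\<^sup>2" for x
  proof -
    have "norm (p x) \<le> norm (p y) + dist y x"
      using norm_p_diff[of x y] norm_triangle_ineq2[of "p x" "p y"] by (simp add: dist_commute)
    \<comment> \<open>Bounding the distance by its square reduces the first moment of
      \<open>p\<close> to the second moment available in \<open>P2\<close>.\<close>
    also have "dist y x \<le> 1 + (dist y x)\<^sup>2"
      using zero_le_power2[of "dist y x - 1/2"] by (simp add: power2_diff power_divide field_simps)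
    finally show ?thesis by simp
  qed
  have "integrable \<mu> (\<lambda>x. norm (p y) + 1 + (dist y x)\<^sup>2)"
    using P2_integrable_square_dist[OF assms] by simp
  then show n: "integrable \<mu> (\<lambda>x. norm (p x))"
    by (rule Bochner_Integration.integrable_bound) (use p_le in auto)
  have "integrable \<mu> (\<lambda>x. norm (p x) * norm w)"
    using n by simp
  then show "integrable \<mu> (\<lambda>x. inner (p x) w)"
    by (rule Bochner_Integration.integrable_bound) (auto simp: Cauchy_Schwarz_ineq2)
qed

text \<open>The barycentre is the weak integral of \<^term>\<open>p\<close>: the Bochner integral is not available, because
  the sort of \<^typ>\<open>'h\<close> does not include the class \<^class>\<open>banach\<close>.\<close>
definition barycentre :: "'a measure \<Rightarrow> 'h" where
  "barycentre \<mu> = (SOME m. \<forall>w. (\<integral>x. inner (p x) w \<partial>\<mu>) = inner m w)"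

text \<open>The left side is linear in \<open>w\<close> and bounded by the first moment of
  \<open>norm (p x)\<close>, so the Riesz theorem supplies the vector that the choice in
  \<open>barycentre\<close> needs.\<close>

lemma inner_barycentre:
  assumes "\<mu> \<in> P2"
  shows "(\<integral>x. inner (p x) w \<partial>\<mu>) = inner (barycentre \<mu>) w"
proof -
  note int = integrable_inner_p[OF assms]
  define f where "f w = (\<integral>x. inner (p x) w \<partial>\<mu>)" for w
  have "bounded_linear f"
  proof (rule bounded_linear_intro)
    show "f (u + v) = f u + f v" for u v
      by (simp add: f_def inner_add_right int)
    show "f (c *\<^sub>R v) = c *\<^sub>R f v" for c v
      by (simp add: f_def)
    show "norm (f v) \<le> norm v * (\<integral>x. norm (p x) \<partial>\<mu>)" for v
    proof -
      have "norm (f v) \<le> (\<integral>x. norm (inner (p x) v) \<partial>\<mu>)"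
        unfolding f_def by (rule integral_norm_bound)
      also have "\<dots> \<le> (\<integral>x. norm v * norm (p x) \<partial>\<mu>)"
        by (intro integral_mono integrable_norm int integrable_mult_right)
          (use Cauchy_Schwarz_ineq2 in \<open>auto simp: mult.commute[of "norm v"]\<close>)
      finally show ?thesis by simp
    qed
  qed
  then obtain m where "\<And>v. f v = inner m v"
    by (rule riesz_representation) blast
  then have "\<exists>m. \<forall>w. (\<integral>x. inner (p x) w \<partial>\<mu>) = inner m w"
    unfolding f_def by blast
  then show ?thesis
    unfolding barycentre_def by (rule someI2_ex) blast
qed

lemma barycentre_translate:
  assumes "\<mu> \<in> P2"
  shows "barycentre (translate_measure v \<mu>) = barycentre \<mu> + v"
proof -
  interpret prob_space \<mu> by (rule P2_D(1)[OF assms])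
  note [measurable_cong] = P2_D(2)[OF assms]
  have "inner (barycentre (translate_measure v \<mu>)) w = inner (barycentre \<mu> + v) w" for w
  proof -
    have "inner (barycentre (translate_measure v \<mu>)) w = (\<integral>x. inner (p x) w \<partial>translate_measure v \<mu>)"
      by (rule inner_barycentre[OF translate_measure_P2[OF assms], symmetric])
    also have "\<dots> = (\<integral>x. inner (p x) w + inner v w \<partial>\<mu>)"
      unfolding translate_measure_def
      by (subst integral_distr) (auto simp: p_translate inner_add_left)
    also have "\<dots> = inner (barycentre \<mu> + v) w"
      by (simp add: integrable_inner_p[OF assms] inner_barycentre[OF assms] inner_add_left prob_space)
    finally show ?thesis .
  qed
  then show ?thesis
    by (metis vector_eq_rdot)
qed

lemma W2_translate_le:
  assumes P2: "\<mu> \<in> P2" "\<nu> \<in> P2"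
  shows "(W2 (translate_measure v \<mu>) (translate_measure w \<nu>))\<^sup>2
    \<le> (W2 \<mu> \<nu>)\<^sup>2 + 2 * inner (barycentre \<mu> - barycentre \<nu>) (v - w) + (norm (v - w))\<^sup>2"
proof (rule field_le_epsilon)
  fix e :: real assume e: "0 < e"
  define R where "R = 2 * inner (barycentre \<mu> - barycentre \<nu>) (v - w) + (norm (v - w))\<^sup>2"
  \<comment> \<open>The slack is added to the squared distance, because the claim compares
    squares.\<close>
  define a where "a = sqrt ((W2 \<mu> \<nu>)\<^sup>2 + e)"
  have a: "a\<^sup>2 = (W2 \<mu> \<nu>)\<^sup>2 + e"
    using e by (simp add: a_def add_nonneg_nonneg)
  have "W2 \<mu> \<nu> < a"
    unfolding a_def using e by (intro real_less_rsqrt) auto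
  then obtain \<pi> where \<pi>: "\<pi> \<in> couplings \<mu> \<nu>" "transport_cost \<pi> < ennreal (a\<^sup>2)"
    using W2_lessE[OF P2] by blast
  interpret prob_space \<pi> by (rule couplings_D(1)[OF \<pi>(1)])
  note int = coupling_integrable_square_dist[OF P2 \<pi>(1)]
  have cost: "(\<integral>z. (dist (fst z) (snd z))\<^sup>2 \<partial>\<pi>) < a\<^sup>2"
    using \<pi>(2) unfolding coupling_transport_cost[OF P2 \<pi>(1)] by (subst (asm) ennreal_less_iff) auto
  have [measurable]: "(\<lambda>x. inner (p x) (v - w)) \<in> borel_measurable borel"
    by measurable
  note inner_int = coupling_integrable[OF \<pi>(1), of "\<lambda>x. inner (p x) (v - w)"]
  have fst_int: "integrable \<pi> (\<lambda>z. inner (p (fst z)) (v - w))"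
    and snd_int: "integrable \<pi> (\<lambda>z. inner (p (snd z)) (v - w))"
    using integrable_inner_p[OF P2(1)] integrable_inner_p[OF P2(2)] by (auto intro!: inner_int(1,2))
  define F where "F z = (dist (\<tau> v (fst z)) (\<tau> w (snd z)))\<^sup>2" for z
  have F: "F = (\<lambda>z. (dist (fst z) (snd z))\<^sup>2
      + 2 * (inner (p (fst z)) (v - w) - inner (p (snd z)) (v - w)) + (norm (v - w))\<^sup>2)"
    by (auto simp: F_def dist_translate inner_diff_left)
  have F_int: "integrable \<pi> F"
    unfolding F using int fst_int snd_int by simp
  have "integral\<^sup>L \<pi> F = (\<integral>z. (dist (fst z) (snd z))\<^sup>2 \<partial>\<pi>) + R"
    unfolding F R_def using int fst_int snd_int
    by (simp add: inner_int(3,4) inner_barycentre P2 inner_diff_left prob_space)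
  with cost have F_le: "integral\<^sup>L \<pi> F \<le> a\<^sup>2 + R"
    by simp
  \<comment> \<open>\<open>R\<close> may be negative; this makes \<open>a\<close> squared plus
    \<open>R\<close> nonnegative, so that its square root can be squared back.\<close>
  have F_nonneg: "0 \<le> integral\<^sup>L \<pi> F"
    by (simp add: F_def)
  define \<pi>' where "\<pi>' = distr \<pi> borel (\<lambda>z. (\<tau> v (fst z), \<tau> w (snd z)))"
  have "\<pi>' \<in> couplings (translate_measure v \<mu>) (translate_measure w \<nu>)"
    unfolding \<pi>'_def translate_measure_def by (intro distr_couplings \<pi>(1)) auto
  moreover have "transport_cost \<pi>' = ennreal (integral\<^sup>L \<pi> F)"
    unfolding \<pi>'_def distr_couplings(2)[OF \<pi>(1) measurable_translate measurable_translate]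
    using F_int by (subst nn_integral_eq_integral[symmetric]) (auto simp: F_def)
  ultimately have "W2 (translate_measure v \<mu>) (translate_measure w \<nu>) \<le> sqrt (a\<^sup>2 + R)"
    using F_le F_nonneg by (intro W2_le) (auto intro: ennreal_leI)
  then have "(W2 (translate_measure v \<mu>) (translate_measure w \<nu>))\<^sup>2 \<le> a\<^sup>2 + R"
    using W2_nonneg F_le F_nonneg by (metis order_trans power_mono real_sqrt_pow2)
  then show "(W2 (translate_measure v \<mu>) (translate_measure w \<nu>))\<^sup>2
    \<le> (W2 \<mu> \<nu>)\<^sup>2 + 2 * inner (barycentre \<mu> - barycentre \<nu>) (v - w) + (norm (v - w))\<^sup>2 + e"
    by (simp add: a R_def)
qed

text \<open>The reverse inequality is \<open>W2_translate_le\<close> for the inverse translations.\<close>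
lemma W2_translate:
  assumes P2: "\<mu> \<in> P2" "\<nu> \<in> P2"
  shows "(W2 (translate_measure v \<mu>) (translate_measure w \<nu>))\<^sup>2
    = (W2 \<mu> \<nu>)\<^sup>2 + 2 * inner (barycentre \<mu> - barycentre \<nu>) (v - w) + (norm (v - w))\<^sup>2"
proof -
  have inverse: "translate_measure (- u) (translate_measure u \<rho>) = \<rho>" if "\<rho> \<in> P2" for u \<rho>
    using that by (simp add: translate_measure_add translate_measure_0)
  have "(norm (- v - - w))\<^sup>2 = (norm (v - w))\<^sup>2"
    by (simp add: norm_minus_commute)
  \<comment> \<open>The barycentres have moved by \<open>v\<close> and \<open>w\<close>. Doubling
    this and adding the quadratic term leaves exactly the negative of the correction in the forward
    inequality.\<close>
  moreover have "inner (barycentre \<mu> + v - (barycentre \<nu> + w)) (- v - - w)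
      = - inner (barycentre \<mu> - barycentre \<nu>) (v - w) - (norm (v - w))\<^sup>2"
    by (simp add: power2_norm_eq_inner inner_simps inner_commute)
  ultimately have "(W2 \<mu> \<nu>)\<^sup>2 \<le> (W2 (translate_measure v \<mu>) (translate_measure w \<nu>))\<^sup>2
      - 2 * inner (barycentre \<mu> - barycentre \<nu>) (v - w) - (norm (v - w))\<^sup>2"
    using W2_translate_le[OF translate_measure_P2[OF P2(1), of v] translate_measure_P2[OF P2(2), of w], of "- v" "- w"]
    by (simp add: inverse P2 barycentre_translate)
  with W2_translate_le[OF P2, of v w] show ?thesis
    by linarith
qed

lemma splits_P2: "splits (P2 :: 'a measure set) W2 TYPE('h)"
proof -
  define Y :: "'a measure set" where "Y = {\<mu> \<in> P2. barycentre \<mu> = 0}"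
  define \<Phi> where "\<Phi> \<mu> = (translate_measure (- barycentre \<mu>) \<mu>, barycentre \<mu>)" for \<mu>
  have "bij_betw \<Phi> P2 (Y \<times> UNIV)"
    by (rule bij_betw_byWitness[where f' = "\<lambda>(\<nu>, v). translate_measure v \<nu>"])
      (auto simp: \<Phi>_def Y_def translate_measure_add translate_measure_0 barycentre_translate
        translate_measure_P2)
  moreover have "prod_dist W2 dist (\<Phi> \<mu>) (\<Phi> \<nu>) = W2 \<mu> \<nu>" if P2: "\<mu> \<in> P2" "\<nu> \<in> P2" for \<mu> \<nu>
  proof -
    have "(W2 (translate_measure (- barycentre \<mu>) \<mu>) (translate_measure (- barycentre \<nu>) \<nu>))\<^sup>2
        = (W2 \<mu> \<nu>)\<^sup>2 - (dist (barycentre \<mu>) (barycentre \<nu>))\<^sup>2"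
      unfolding W2_translate[OF P2]
      by (simp add: dist_norm power2_norm_eq_inner inner_simps inner_commute)
    then show ?thesis
      by (simp add: \<Phi>_def prod_dist_def W2_nonneg)
  qed
  ultimately have "isometric (P2 :: 'a measure set) W2 (Y \<times> (UNIV :: 'h set)) (prod_dist W2 dist)"
    unfolding isometric_def by blast
  moreover have "Metric_space Y W2"
    by (rule Metric_space.subspace[OF Metric_space_P2]) (auto simp: Y_def)
  ultimately show ?thesis
    unfolding splits_def using Metric_space_P2 by blast
qed

end

theorem theorem1p3:
  assumes "splits (UNIV :: 'a::polish_space set) dist TYPE('h::{real_inner, polish_space})"
  shows "splits (P2 :: 'a measure set) W2 TYPE('h)"
proof -
  obtain Y :: "'a set" and dY and f :: "'a \<Rightarrow> 'a \<times> 'h" where Y: "Metric_space Y dY"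
    and bij: "bij_betw f UNIV (Y \<times> UNIV)" and iso: "\<And>x y. prod_dist dY dist (f x) (f y) = dist x y"
    using assms unfolding splits_def isometric_def by auto
  define p where "p x = snd (f x)" for x
  define \<tau> where "\<tau> v x = inv f (fst (f x), snd (f x) + v)" for v x
  have inv_f: "inv f (f x) = x" for x
    using bij by (simp add: bij_betw_def)
  have f\<tau>: "f (\<tau> v x) = (fst (f x), snd (f x) + v)" for v x
  proof -
    \<comment> \<open>The inverse of \<open>f\<close> cancels only on
      \<open>Y \<times> UNIV\<close>; adding \<open>v\<close> stays there because the second factor
      is the whole Hilbert space.\<close>
    have "fst (f x) \<in> Y"
      using bij_betwE[OF bij] by (auto simp: mem_Times_iff)
    then show ?thesis
      unfolding \<tau>_def by (intro bij_betw_inv_into_right[OF bij]) auto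
  qed
  have dist2: "(dist x y)\<^sup>2 = (dY (fst (f x)) (fst (f y)))\<^sup>2 + (norm (snd (f x) - snd (f y)))\<^sup>2" for x y
    unfolding iso[symmetric] by (simp add: prod_dist_def case_prod_unfold dist_norm)
  have "hilbert_translations p \<tau>"
  proof
    show "(dist (\<tau> v x) (\<tau> w y))\<^sup>2
      = (dist x y)\<^sup>2 + 2 * inner (p x - p y) (v - w) + (norm (v - w))\<^sup>2" for v w x y
      unfolding dist2 f\<tau> p_def
      by (simp add: power2_norm_eq_inner inner_simps inner_commute)
    show "\<tau> v (\<tau> w x) = \<tau> (v + w) x" for v w x
      \<comment> \<open>Only the outer translations are unfolded, so that \<open>f\<tau>\<close> can
        evaluate \<open>f\<close> at the inner one.\<close>
      unfolding \<tau>_def[of v] \<tau>_def[of "v + w"] f\<tau> by (simp add: ac_simps)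
    show "\<tau> 0 x = x" for x
      by (simp add: \<tau>_def inv_f)
    show "p (\<tau> v x) = p x + v" for v x
      by (simp add: p_def f\<tau>)
    show "norm (p x - p y) \<le> dist x y" for x y
      by (rule power2_le_imp_le) (auto simp: dist2 p_def)
  qed
  then show ?thesis
    by (rule hilbert_translations.splits_P2)
qed

end
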